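(* Let $m\ge0$ and let $M_m$ be the $(m+1)\times(m+1)$ matrix converting Legendre coefficients to Bernstein coefficients of degree $m$. Then the largest singular value of $M_m^{-1}$ is $\sigma_{\max}(M_m^{-1})=1/\sqrt{m+1}$. Consequently, for every $\Delta>0$, every complex polynomial $\mathbf{w}(t)$ of degree at most $m$, and every perturbation $\delta\mathbf{w}(t)=\sum_{k=0}^m\delta\mathbf{w}_k\,b_k^m(t)$ with coefficient vector $\delta\mathbf{W}=(\delta\mathbf{w}_0,\dots,\delta\mathbf{w}_m)^T\in\mathbb{C}^{m+1}$ satisfying $\|\delta\mathbf{W}\|_2\le\sqrt{m+1}\,\Delta$, one has $$\mathrm{distance}(\mathbf{w},\mathbf{w}+\delta\mathbf{w})=\|\delta\mathbf{w}\|\le\Delta.$$ In particular, this holds if $|\delta\mathbf{w}_0|=\cdots=|\delta\mathbf{w}_m|=r$ with $r\le\Delta$.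
   Context: For a complex polynomial $\mathbf{u}$ in the real variable $t\in[0,1]$, $\|\mathbf{u}\|=\left(\int_0^1|\mathbf{u}(t)|^2\,dt\right)^{1/2}$ and $\mathrm{distance}(\mathbf{u},\mathbf{v})=\|\mathbf{u}-\mathbf{v}\|$. $\|\cdot\|_2$ is the standard Euclidean norm on $\mathbb{C}^{m+1}$. $b_k^m(t)=\binom{m}{k}(1-t)^{m-k}t^k$ is the Bernstein basis and $L_k(t)=\sqrt{2k+1}\sum_{i=0}^k(-1)^{k+i}\binom{k}{i}b_i^k(t)$ are the orthonormal Legendre polynomials on $[0,1]$, $\int_0^1L_jL_k\,dt=\delta_{jk}$. $M_m$ is the invertible real matrix such that $\sum_kc_kL_k=\sum_jd_jb_j^m$ if and only if $(d_0,\dots,d_m)^T=M_m(c_0,\dots,c_m)^T$. *)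

theory Defs
  imports
    "HOL-Analysis.Analysis"
    "Jordan_Normal_Form.Gauss_Jordan_Elimination"
    "Jordan_Normal_Form.Spectral_Radius"
begin

(* Both HOL-Analysis and Jordan_Normal_Form use $ for vector components; here $ is the latter. *)
no_notation Finite_Cartesian_Product.vec_nth (infixl "$" 90)

definition poly_norm :: "complex poly \<Rightarrow> real"
  where "poly_norm u = sqrt (integral {0..1} (\<lambda>t::real. (cmod (poly u (complex_of_real t)))\<^sup>2))"

definition poly_distance :: "complex poly \<Rightarrow> complex poly \<Rightarrow> real"
  where "poly_distance u v = poly_norm (u - v)"

definition bernstein_poly :: "nat \<Rightarrow> nat \<Rightarrow> complex poly"
  where "bernstein_poly m k = Polynomial.smult (of_nat (m choose k)) ([:1, -1:] ^ (m - k) * [:0, 1:] ^ k)"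

lemma poly_bernstein_poly:
  "poly (bernstein_poly m k) (complex_of_real t) = complex_of_real (Bernstein m k t)"
  by (simp add: bernstein_poly_def Bernstein_def)

definition legendre_poly :: "nat \<Rightarrow> complex poly"
  where "legendre_poly k =
    Polynomial.smult (complex_of_real (sqrt (2 * real k + 1)))
      (\<Sum>i\<le>k. Polynomial.smult ((-1) ^ (k + i) * of_nat (k choose i)) (bernstein_poly k i))"

definition legendre_to_bernstein :: "nat \<Rightarrow> real mat"
  where "legendre_to_bernstein m = (THE M.
    M \<in> carrier_mat (m + 1) (m + 1) \<and> invertible_mat M \<and>
    (\<forall>c \<in> carrier_vec (m + 1). \<forall>d \<in> carrier_vec (m + 1).
       (\<Sum>k\<le>m. Polynomial.smult (c $ k) (legendre_poly k)) = (\<Sum>j\<le>m. Polynomial.smult (d $ j) (bernstein_poly m j))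
       \<longleftrightarrow> d = map_mat complex_of_real M *\<^sub>v c))"

definition singular_values :: "real mat \<Rightarrow> real set"
  where "singular_values A = sqrt ` spectrum (transpose_mat A * A)"

definition sigma_max :: "real mat \<Rightarrow> real"
  where "sigma_max A = Max (singular_values A)"

end

theory Submission
  imports Defs
begin

text \<open>
Let \<open>A\<close> be the matrix \<open>bernstein_to_legendre m\<close> of the inner products of the Legendre with the
Bernstein polynomials. Once the Legendre polynomials are known to be orthonormal
(\<open>legendre_orthonormal\<close>), \<open>A\<close> is the inverse of the conversion matrix
(\<open>mat_inverse_legendre_to_bernstein\<close>), and Parseval's identity says that \<open>|A v|\<close> is the norm of
the polynomial with Bernstein coefficients \<open>v\<close>. Thus the singular values of \<open>A\<close> measure how large
a polynomial can be in terms of its Bernstein coefficients, and both halves of the theorem rest on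
one estimate (\<open>bernstein_norm_bound\<close>): since the Bernstein polynomials form a partition of unity
into nonnegative functions of equal integral \<open>1 / (m + 1)\<close>, the squared norm of a Bernstein sum is
at most \<open>1 / (m + 1)\<close> times the sum of the squared moduli of its coefficients.

The estimate bounds every eigenvalue of \<open>A\<^sup>T A\<close>, and the constant polynomial 1, all of whose
Bernstein coefficients are 1, attains the bound (\<open>bernstein_to_legendre_eigenvalue_max\<close>).

Orthonormality reduces to a finite difference: the integral of the \<open>i\<close>-th Bernstein polynomial of
degree \<open>k\<close> against \<open>t ^ j\<close> is a polynomial of degree \<open>j\<close> in \<open>i\<close>, and the Legendre coefficients
form its \<open>k\<close>-th difference, which vanishes for \<open>j < k\<close> (\<open>unit_integral_legendre_monom\<close>).
\<close>

section \<open>Integration of polynomials over the unit interval\<close>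

lemma has_integral_power_mult_power:
  "((\<lambda>t::real. t ^ a * (1 - t) ^ b) has_integral fact a * fact b / fact (a + b + 1)) {0..1}"
proof -
  have "Beta (real a + 1) (real b + 1) = fact a * fact b / fact (a + b + 1)"
    using Gamma_fact[of a, where 'a = real] Gamma_fact[of b, where 'a = real]
      Gamma_fact[of "a + b + 1", where 'a = real]
    by (simp add: Beta_def add_ac)
  moreover have "((\<lambda>t. t powr (real a + 1 - 1) * (1 - t) powr (real b + 1 - 1))
      has_integral Beta (real a + 1) (real b + 1)) {0..1}"
    by (rule has_integral_Beta_real) auto
  ultimately have "((\<lambda>t. t powr real a * (1 - t) powr real b)
      has_integral fact a * fact b / fact (a + b + 1)) {0..1}"
    by simp
  \<comment> \<open>Since \<open>0 powr 0 = 0\<close> while \<open>0 ^ 0 = 1\<close>, the integrands may differ at the end points.\<close>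
  then show ?thesis
    by (rule has_integral_spike_finite[of "{0, 1}", rotated 2]) (auto simp: powr_realpow)
qed

text \<open>In every product \<open>p * q\<close> integrated below one factor is real on the real line, so that its
integral is the \<open>L\<^sup>2\<close> inner product of the two factors although nothing is conjugated.\<close>
definition unit_integral :: "complex poly \<Rightarrow> complex"
  where "unit_integral p = integral {0..1} (\<lambda>t. poly p (complex_of_real t))"

lemma integrable_poly: "(\<lambda>t. poly p (complex_of_real t)) integrable_on {0..1}"
  by (intro integrable_continuous_interval continuous_intros)

lemma unit_integral_add: "unit_integral (p + q) = unit_integral p + unit_integral q"
  by (simp add: unit_integral_def integral_add integrable_poly)

lemma unit_integral_smult: "unit_integral (Polynomial.smult c p) = c * unit_integral p"
  by (simp add: unit_integral_def)

lemma unit_integral_sum: "unit_integral (\<Sum>i\<in>A. p i) = (\<Sum>i\<in>A. unit_integral (p i))"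
  by (induction A rule: infinite_finite_induct) (simp_all add: unit_integral_add, simp_all add: unit_integral_def)

lemma unit_integral_of_real:
  assumes "\<And>t. poly p (complex_of_real t) = complex_of_real (f t)"
    and "(f has_integral I) {0..1}"
  shows "unit_integral p = complex_of_real I"
  unfolding unit_integral_def assms(1)
  by (intro integral_unique has_integral_of_real assms(2))

text \<open>A Beta integral. The binomial coefficient of the Bernstein polynomial cancels the factorials that
depend on \<open>k - i\<close>, so what depends on \<open>i\<close> is a polynomial of degree \<open>j\<close> in \<open>i\<close>; finite
differences of order above \<open>j\<close> will annihilate it.\<close>
lemma unit_integral_bernstein_monom:
  assumes "i \<le> k"
  shows "unit_integral (bernstein_poly k i * Polynomial.monom 1 j)
    = fact k * fact j / fact (k + j + 1) * of_nat ((i + j) choose j)"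
proof -
  have "((\<lambda>t. real (k choose i) * (t ^ (i + j) * (1 - t) ^ (k - i))) has_integral
      real (k choose i) * (fact (i + j) * fact (k - i) / fact (i + j + (k - i) + 1))) {0..1}"
    by (intro has_integral_mult_right has_integral_power_mult_power)
  moreover have "poly (bernstein_poly k i * Polynomial.monom 1 j) (complex_of_real t)
     = complex_of_real (real (k choose i) * (t ^ (i + j) * (1 - t) ^ (k - i)))" for t
    by (simp add: poly_bernstein_poly Bernstein_def poly_monom power_add)
  ultimately have "unit_integral (bernstein_poly k i * Polynomial.monom 1 j) = complex_of_real
      (real (k choose i) * (fact (i + j) * fact (k - i) / fact (i + j + (k - i) + 1)))"
    by (rule unit_integral_of_real[rotated])
  also have "real (k choose i) * (fact (i + j) * fact (k - i) / fact (i + j + (k - i) + 1))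
     = fact k * fact j / fact (k + j + 1) * real ((i + j) choose j)"
    using assms by (simp add: binomial_fact field_simps)
  finally show ?thesis by simp
qed

section \<open>Orthonormality of the Legendre polynomials\<close>

text \<open>The alternating binomial sum of order \<open>k\<close> is the \<open>k\<close>-th forward difference at 0, and the
difference of order \<open>k + 1\<close> is the difference of two of order \<open>k\<close>.\<close>
lemma alternating_sum_Suc:
  fixes f :: "nat \<Rightarrow> 'a::comm_ring_1"
  shows "(\<Sum>i\<le>Suc k. (-1) ^ (Suc k + i) * of_nat (Suc k choose i) * f i)
    = (\<Sum>i\<le>k. (-1) ^ (k + i) * of_nat (k choose i) * f (Suc i))
      - (\<Sum>i\<le>k. (-1) ^ (k + i) * of_nat (k choose i) * f i)"
proof -
  have "(\<Sum>i\<le>k. (-1) ^ (k + i) * of_nat (k choose i) * f i)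
    = (\<Sum>i\<le>Suc k. (-1) ^ (k + i) * of_nat (k choose i) * f i)"
    by (simp add: binomial_eq_0)
  also have "\<dots> = (-1)^k * f 0 - (\<Sum>i\<le>k. (-1) ^ (k + i) * of_nat (k choose Suc i) * f (Suc i))"
    by (subst sum.atMost_Suc_shift) (simp add: sum_negf)
  finally show ?thesis
    by (subst sum.atMost_Suc_shift) (simp add: algebra_simps sum.distrib)
qed

text \<open>Each forward difference lowers the lower index of a binomial coefficient by one, by Pascal's rule.
The shift \<open>n\<close> is general because the induction step compares \<open>n\<close> with \<open>n + 1\<close>.\<close>
lemma alternating_sum_choose:
  "(\<Sum>i\<le>k. (-1) ^ (k + i) * of_nat (k choose i) * of_nat ((n + i) choose r))
    = (if k \<le> r then of_nat (n choose (r - k)) else (0::'a::comm_ring_1))"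
proof (induction k arbitrary: n)
  case (Suc k)
  have "(\<Sum>i\<le>Suc k. (-1) ^ (Suc k + i) * of_nat (Suc k choose i) * of_nat ((n + i) choose r))
    = (if k \<le> r then of_nat (Suc n choose (r - k)) else (0::'a))
      - (if k \<le> r then of_nat (n choose (r - k)) else 0)"
    unfolding alternating_sum_Suc Suc.IH[symmetric] by simp
  also have "\<dots> = (if Suc k \<le> r then of_nat (n choose (r - Suc k)) else 0)"
  proof (cases "Suc k \<le> r")
    case True
    then have "r - k = Suc (r - Suc k)" by simp
    with True show ?thesis by simp
  qed auto
  finally show ?case .
qed simp

text \<open>The integral is a multiple of the \<open>k\<close>-th forward difference of the degree-\<open>j\<close> polynomial
\<open>i \<mapsto> ((j + i) choose j)\<close>: it vanishes below degree \<open>k\<close>, and for \<open>j = k\<close> the difference is 1.\<close>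
lemma unit_integral_legendre_monom:
  assumes "j \<le> k"
  shows "unit_integral (legendre_poly k * Polynomial.monom 1 j)
    = (if j = k then complex_of_real (sqrt (2 * real k + 1)) * (fact k)\<^sup>2 / fact (2 * k + 1) else 0)"
proof -
  define D :: complex where "D = fact k * fact j / fact (k + j + 1)"
  have D: "unit_integral (bernstein_poly k i * Polynomial.monom 1 j) = D * of_nat ((j + i) choose j)"
    if "i \<le> k" for i
    using unit_integral_bernstein_monom[OF that, of j] unfolding D_def by (simp only: add.commute[of i j])
  have "unit_integral (legendre_poly k * Polynomial.monom 1 j) =
     complex_of_real (sqrt (2 * real k + 1)) * (\<Sum>i\<le>k. (-1) ^ (k + i) * of_nat (k choose i) *
       (unit_integral (bernstein_poly k i * Polynomial.monom 1 j)))"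
    by (simp add: legendre_poly_def unit_integral_smult unit_integral_sum sum_distrib_right)
  also have "\<dots> = complex_of_real (sqrt (2 * real k + 1)) * D *
     (\<Sum>i\<le>k. (-1) ^ (k + i) * of_nat (k choose i) * of_nat ((j + i) choose j))"
    unfolding sum_distrib_left by (intro sum.cong) (simp_all add: D)
  also have "(\<Sum>i\<le>k. (-1) ^ (k + i) * of_nat (k choose i) * of_nat ((j + i) choose j))
     = (if j = k then 1 else (0 :: complex))"
    using assms unfolding alternating_sum_choose by simp
  finally have "unit_integral (legendre_poly k * Polynomial.monom 1 j)
    = complex_of_real (sqrt (2 * real k + 1)) * D * (if j = k then 1 else 0)" .
  moreover have "D = (fact k)\<^sup>2 / fact (2 * k + 1)" if "j = k"
    unfolding D_def that by (simp only: power2_eq_square mult_2)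
  ultimately show ?thesis by simp
qed

text \<open>Orthogonality to all lower degrees leaves only the top coefficient of \<open>q\<close>. Both the vanishing and
the normalisation of the Legendre inner products are read off from this formula.\<close>
lemma unit_integral_legendre_mult:
  assumes "degree q \<le> k"
  shows "unit_integral (legendre_poly k * q)
    = complex_of_real (sqrt (2 * real k + 1)) * (fact k)\<^sup>2 / fact (2 * k + 1) * coeff q k"
proof -
  have "q = (\<Sum>j\<le>k. Polynomial.smult (coeff q j) (Polynomial.monom 1 j))"
    using poly_as_sum_of_monoms'[OF assms] by (simp add: smult_monom)
  then have "unit_integral (legendre_poly k * q)
     = unit_integral (\<Sum>j\<le>k. Polynomial.smult (coeff q j) (legendre_poly k * Polynomial.monom 1 j))"
    by (metis (no_types, lifting) mult_smult_right sum.cong sum_distrib_left)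
  also have "\<dots> = (\<Sum>j\<le>k. coeff q j * unit_integral (legendre_poly k * Polynomial.monom 1 j))"
    by (simp add: unit_integral_sum unit_integral_smult)
  also have "\<dots> = (\<Sum>j\<le>k. if j = k then complex_of_real (sqrt (2 * real k + 1)) * (fact k)\<^sup>2 / fact (2 * k + 1) * coeff q k else 0)"
    by (intro sum.cong) (auto simp: unit_integral_legendre_monom)
  finally show ?thesis by simp
qed

lemma bernstein_poly_degree: "i \<le> k \<Longrightarrow> degree (bernstein_poly k i) \<le> k"
  and bernstein_poly_top_coeff:
    "i \<le> k \<Longrightarrow> coeff (bernstein_poly k i) k = (-1) ^ (k - i) * of_nat (k choose i)"
proof -
  assume i: "i \<le> k"
  let ?p = "[:1, -1:] ^ (k - i) :: complex poly" and ?q = "[:0, 1:] ^ i :: complex poly"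
  have d: "degree ?p = k - i" "degree ?q = i" by (simp_all add: degree_power_eq)
  have c: "coeff ?p (k - i) = (-1) ^ (k - i)" "coeff ?q i = 1"
    using lead_coeff_power[of "[:1, -1:] :: complex poly" "k - i"]
      lead_coeff_power[of "[:0, 1:] :: complex poly" i] by (simp_all add: d)
  have "degree (?p * ?q) \<le> k"
    using degree_mult_le[of ?p ?q] i by (simp add: d)
  then show "degree (bernstein_poly k i) \<le> k"
    unfolding bernstein_poly_def by (meson degree_smult_le order.trans)
  show "coeff (bernstein_poly k i) k = (-1) ^ (k - i) * of_nat (k choose i)"
    using coeff_mult_degree_sum[of ?p ?q] i by (simp add: bernstein_poly_def d c)
qed

lemma degree_legendre_poly: "degree (legendre_poly k) \<le> k"
  unfolding legendre_poly_def
  by (intro order.trans[OF degree_smult_le] degree_sum_le)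
    (auto intro: order.trans[OF degree_smult_le] bernstein_poly_degree)

text \<open>The signs of the Legendre coefficients cancel those of the top Bernstein coefficients, and the sum
of the squares of the binomial coefficients is the central one.\<close>
lemma coeff_legendre_poly:
  "coeff (legendre_poly k) k = complex_of_real (sqrt (2 * real k + 1)) * of_nat ((2 * k) choose k)"
proof -
  have "(- 1) ^ (k + i) * of_nat (k choose i) * coeff (bernstein_poly k i) k = of_nat ((k choose i)\<^sup>2)"
    if "i \<le> k" for i
  proof -
    have "(- 1::complex) ^ (k + i) * (-1) ^ (k - i) = 1"
      unfolding power_add[symmetric] using that by simp
    then show ?thesis
      using that by (simp add: bernstein_poly_top_coeff power2_eq_square mult_ac)
  qed
  then show ?thesis
    by (simp add: legendre_poly_def coeff_sum choose_square_sum[symmetric] del: of_nat_power)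
qed

lemma legendre_orthonormal:
  "unit_integral (legendre_poly j * legendre_poly k) = (if j = k then 1 else 0)"
proof -
  have less: "unit_integral (legendre_poly k * legendre_poly j) = 0" if "j < k" for j k
    using that degree_legendre_poly[of j]
    by (subst unit_integral_legendre_mult) (auto intro: coeff_eq_0)
  have "unit_integral (legendre_poly k * legendre_poly k) = 1"
  proof -
    let ?s = "complex_of_real (sqrt (2 * real k + 1))"
    have "?s * ?s = 2 * of_nat k + 1"
      unfolding of_real_mult[symmetric] by simp
    moreover have "of_nat ((2 * k) choose k) = (fact (2 * k) / (fact k)\<^sup>2 :: complex)"
      by (simp add: binomial_fact power2_eq_square)
    moreover have "fact (2 * k + 1) = (2 * of_nat k + 1 :: complex) * fact (2 * k)"
      by simp
    moreover have "(2 * of_nat k + 1 :: complex) \<noteq> 0"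
      by (metis Suc_eq_plus1 of_nat_Suc of_nat_mult of_nat_neq_0 of_nat_numeral add.commute)
    ultimately show ?thesis
      by (simp add: unit_integral_legendre_mult degree_legendre_poly coeff_legendre_poly del: fact_Suc)
  qed
  with less[of j k] less[of k j] show ?thesis
    by (cases j k rule: linorder_cases) (simp_all add: mult.commute)
qed

section \<open>The norm of a polynomial in Bernstein form\<close>

lemma has_integral_Bernstein:
  assumes "k \<le> m"
  shows "(Bernstein m k has_integral 1 / real (m + 1)) {0..1}"
proof -
  have "((\<lambda>t. real (m choose k) * (t ^ k * (1 - t) ^ (m - k))) has_integral
      real (m choose k) * (fact k * fact (m - k) / fact (k + (m - k) + 1))) {0..1}"
    by (intro has_integral_mult_right has_integral_power_mult_power)
  moreover have "real (m choose k) * (fact k * fact (m - k) / fact (k + (m - k) + 1)) = 1 / real (m + 1)"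
  proof -
    have "fact k * fact (m - k) * real (m choose k) = fact m"
      using assms by (simp add: binomial_fact)
    then show ?thesis
      using assms by (simp add: mult_ac)
  qed
  ultimately show ?thesis
    by (simp add: Bernstein_def[abs_def] mult.assoc)
qed

text \<open>Bernstein polynomials are nonnegative on \<open>[0, 1]\<close> and add up to 1, so a Bernstein sum is a convex
combination of its coefficients; by Cauchy--Schwarz the square of its modulus is at most the same
combination of the squared moduli. All weights have the integral \<open>1 / (m + 1)\<close>.\<close>
lemma bernstein_norm_bound:
  "(poly_norm (\<Sum>k\<le>m. Polynomial.smult (d k) (bernstein_poly m k)))\<^sup>2 \<le> (\<Sum>k\<le>m. (cmod (d k))\<^sup>2) / real (m + 1)"
proof -
  let ?p = "\<Sum>k\<le>m. Polynomial.smult (d k) (bernstein_poly m k)"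
  let ?f = "\<lambda>t. (cmod (poly ?p (complex_of_real t)))\<^sup>2"
  let ?g = "\<lambda>t. \<Sum>k\<le>m. (cmod (d k))\<^sup>2 * Bernstein m k t"
  have le: "?f t \<le> ?g t" if t: "t \<in> {0..1}" for t
  proof -
    have B: "Bernstein m k t \<ge> 0" for k
      using t by (simp add: Bernstein_nonneg)
    have "cmod (poly ?p (complex_of_real t)) \<le> (\<Sum>k\<le>m. cmod (d k * complex_of_real (Bernstein m k t)))"
      by (simp add: poly_sum poly_bernstein_poly norm_sum)
    also have "\<dots> = (\<Sum>k\<le>m. (cmod (d k) * sqrt (Bernstein m k t)) * sqrt (Bernstein m k t))"
      by (simp add: norm_mult B mult.assoc)
    finally have "?f t \<le> (\<Sum>k\<le>m. (cmod (d k) * sqrt (Bernstein m k t)) * sqrt (Bernstein m k t))\<^sup>2"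
      by (rule power_mono) simp
    also have "\<dots> \<le> (\<Sum>k\<le>m. (cmod (d k) * sqrt (Bernstein m k t))\<^sup>2) * (\<Sum>k\<le>m. (sqrt (Bernstein m k t))\<^sup>2)"
      by (rule Cauchy_Schwarz_ineq_sum)
    also have "\<dots> = ?g t"
      by (simp add: B power_mult_distrib)
    finally show ?thesis .
  qed
  have g: "(?g has_integral (\<Sum>k\<le>m. (cmod (d k))\<^sup>2 * (1 / real (m + 1)))) {0..1}"
    by (intro has_integral_sum has_integral_mult_right has_integral_Bernstein) auto
  have f: "?f integrable_on {0..1}"
    by (intro integrable_continuous_interval continuous_intros)
  have "(poly_norm ?p)\<^sup>2 = integral {0..1} ?f"
    unfolding poly_norm_def by (intro real_sqrt_pow2 integral_nonneg f) simp
  also have "\<dots> \<le> (\<Sum>k\<le>m. (cmod (d k))\<^sup>2 * (1 / real (m + 1)))"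
    using integral_le[OF f has_integral_integrable[OF g] le] by (simp add: integral_unique[OF g])
  finally show ?thesis by (simp add: sum_divide_distrib)
qed

section \<open>The change of basis and its inverse\<close>

text \<open>Multiply by \<open>(t + (1 - t)) ^ (m - k) = 1\<close> and expand.\<close>
lemma bernstein_elevation:
  assumes "i \<le> k" "k \<le> m"
  shows "bernstein_poly k i = (\<Sum>j\<le>m. Polynomial.smult (complex_of_real
     (if i \<le> j \<and> j \<le> i + (m - k) then real (k choose i) * real ((m - k) choose (j - i)) / real (m choose j) else 0))
       (bernstein_poly m j))"
    (is "_ = (\<Sum>j\<le>m. Polynomial.smult (complex_of_real (?e j)) _)")
proof -
  let ?X = "[:1, -1:] :: complex poly" and ?Y = "[:0, 1:] :: complex poly"
  have "?Y + ?X = 1" by (simp add: one_pCons)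
  then have "bernstein_poly k i = bernstein_poly k i * (?Y + ?X) ^ (m - k)"
    by (simp only: power_one mult_1_right)
  also have "\<dots> = (\<Sum>l\<le>m-k. Polynomial.smult (of_nat (k choose i) * of_nat (m - k choose l))
      (?X ^ (k - i) * ?Y ^ i * (?Y ^ l * ?X ^ (m - k - l))))"
    unfolding binomial_ring
    by (simp add: sum_distrib_left bernstein_poly_def of_nat_poly smult_sum2 mult_ac)
  also have "\<dots> = (\<Sum>l\<in>{0..m-k}. Polynomial.smult (complex_of_real (?e (l + i))) (bernstein_poly m (l + i)))"
  proof (intro sum.cong)
    fix l assume "l \<in> {0..m-k}"
    then have l: "l + i \<le> m" "m - (l + i) = (k - i) + (m - k - l)" "l \<le> m - k" using assms by auto
    have "?X ^ (k - i) * ?Y ^ i * (?Y ^ l * ?X ^ (m - k - l)) = ?X ^ (m - (l + i)) * ?Y ^ (l + i)"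
      unfolding l(2) power_add by (simp only: mult_ac)
    then show "Polynomial.smult (of_nat (k choose i) * of_nat (m - k choose l))
      (?X ^ (k - i) * ?Y ^ i * (?Y ^ l * ?X ^ (m - k - l))) = Polynomial.smult (complex_of_real (?e (l + i))) (bernstein_poly m (l + i))"
      using l(1,3) unfolding bernstein_poly_def by simp
  qed auto
  also have "\<dots> = (\<Sum>j\<in>{0+i..m-k+i}. Polynomial.smult (complex_of_real (?e j)) (bernstein_poly m j))"
    by (rule sum.shift_bounds_cl_nat_ivl[symmetric])
  also have "\<dots> = (\<Sum>j\<le>m. Polynomial.smult (complex_of_real (?e j)) (bernstein_poly m j))"
    using assms by (intro sum.mono_neutral_left) auto
  finally show ?thesis .
qed

lemma legendre_poly_bernstein:
  assumes "k \<le> m"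
  shows "\<exists>e. legendre_poly k = (\<Sum>j\<le>m. Polynomial.smult (complex_of_real (e j)) (bernstein_poly m j))"
proof -
  have "\<forall>i\<in>{..k}. \<exists>e. bernstein_poly k i = (\<Sum>j\<le>m. Polynomial.smult (complex_of_real (e j)) (bernstein_poly m j))"
    by (intro ballI exI, rule bernstein_elevation) (use assms in auto)
  from bchoice[OF this] obtain e where e: "\<And>i. i \<le> k \<Longrightarrow>
      bernstein_poly k i = (\<Sum>j\<le>m. Polynomial.smult (complex_of_real (e i j)) (bernstein_poly m j))"
    by auto
  let ?c = "\<lambda>i. (-1) ^ (k + i) * real (k choose i)"
  have "legendre_poly k = (\<Sum>i\<le>k. \<Sum>j\<le>m. Polynomial.smult
      (complex_of_real (sqrt (2 * real k + 1) * (?c i * e i j))) (bernstein_poly m j))"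
    by (simp add: legendre_poly_def e smult_sum2)
  also have "\<dots> = (\<Sum>j\<le>m. Polynomial.smult (complex_of_real (\<Sum>i\<le>k. sqrt (2 * real k + 1) * (?c i * e i j)))
      (bernstein_poly m j))"
    by (subst sum.swap) (simp add: smult_sum)
  finally show ?thesis by (intro exI)
qed

lemma sum_bernstein_poly: "(\<Sum>j\<le>m. bernstein_poly m j) = 1"
proof -
  have "[:0, 1:] + [:1, -1:] = (1 :: complex poly)" by (simp add: one_pCons)
  then have "(1 :: complex poly) = ([:0, 1:] + [:1, -1:]) ^ m" by (simp only: power_one)
  also have "\<dots> = (\<Sum>j\<le>m. bernstein_poly m j)"
    unfolding binomial_ring by (simp add: bernstein_poly_def of_nat_poly mult_ac)
  finally show ?thesis ..
qed

lemma legendre_poly_0: "legendre_poly 0 = 1"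
  by (simp add: legendre_poly_def bernstein_poly_def)

lemma poly_legendre_poly_of_real:
  "poly (legendre_poly k) (complex_of_real t) = complex_of_real
    (sqrt (2 * real k + 1) * (\<Sum>i\<le>k. (-1) ^ (k + i) * real (k choose i) * Bernstein k i t))"
  by (simp add: legendre_poly_def poly_sum poly_bernstein_poly)

lemma unit_integral_legendre_bernstein_real:
  "complex_of_real (Re (unit_integral (legendre_poly k * bernstein_poly m j)))
    = unit_integral (legendre_poly k * bernstein_poly m j)"
proof -
  let ?f = "\<lambda>t. (sqrt (2 * real k + 1) * (\<Sum>i\<le>k. (-1) ^ (k + i) * real (k choose i) * Bernstein k i t)) * Bernstein m j t"
  have "?f integrable_on {0..1}"
    unfolding Bernstein_def by (intro integrable_continuous_interval continuous_intros)
  then have "unit_integral (legendre_poly k * bernstein_poly m j) = complex_of_real (integral {0..1} ?f)"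
    by (intro unit_integral_of_real) (auto simp: poly_legendre_poly_of_real poly_bernstein_poly has_integral_integrable_integral)
  then show ?thesis by simp
qed

text \<open>By orthonormality, the Legendre coefficients of a polynomial are its inner products with the
Legendre polynomials; this gives the inverse of the conversion matrix without inverting anything.\<close>
definition bernstein_to_legendre :: "nat \<Rightarrow> real mat"
  where "bernstein_to_legendre m = mat (m + 1) (m + 1)
    (\<lambda>(k, j). Re (unit_integral (legendre_poly k * bernstein_poly m j)))"

lemma bernstein_to_legendre_carrier: "bernstein_to_legendre m \<in> carrier_mat (m + 1) (m + 1)"
  by (simp add: bernstein_to_legendre_def)

lemma bernstein_to_legendre_entry:
  assumes "k \<le> m" "j \<le> m"
  shows "complex_of_real (bernstein_to_legendre m $$ (k, j)) = unit_integral (legendre_poly k * bernstein_poly m j)"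
  using assms by (simp add: bernstein_to_legendre_def unit_integral_legendre_bernstein_real)

lemma index_mult_mat_vec_atMost:
  assumes "A \<in> carrier_mat (m + 1) (m + 1)" "v \<in> carrier_vec (m + 1)" "i \<le> m"
  shows "(A *\<^sub>v v) $ i = (\<Sum>j\<le>m. A $$ (i, j) * v $ j)"
  using assms by (simp add: scalar_prod_def row_def atLeast0LessThan lessThan_Suc_atMost)

lemma mult_mat_unit_vec:
  fixes A :: "'a::semiring_1 mat"
  assumes "A \<in> carrier_mat n n" "k < n"
  shows "A *\<^sub>v unit_vec n k = col A k"
  by (rule eq_vecI) (use assms in auto)

lemma unit_integral_legendre_sum:
  assumes "l \<le> m"
  shows "unit_integral (legendre_poly l * (\<Sum>k\<le>m. Polynomial.smult (c k) (legendre_poly k))) = c l"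
proof -
  have "unit_integral (legendre_poly l * (\<Sum>k\<le>m. Polynomial.smult (c k) (legendre_poly k)))
     = (\<Sum>k\<le>m. if l = k then c k else 0)"
    by (simp add: sum_distrib_left unit_integral_sum unit_integral_smult legendre_orthonormal if_distrib cong: if_cong)
  with assms show ?thesis by simp
qed

lemma unit_integral_bernstein_sum:
  assumes "l \<le> m" "d \<in> carrier_vec (m + 1)"
  shows "unit_integral (legendre_poly l * (\<Sum>j\<le>m. Polynomial.smult (d $ j) (bernstein_poly m j)))
    = (map_mat complex_of_real (bernstein_to_legendre m) *\<^sub>v d) $ l"
proof -
  note C = bernstein_to_legendre_carrier[of m]
  have "(map_mat complex_of_real (bernstein_to_legendre m) *\<^sub>v d) $ l =
     (\<Sum>j\<le>m. map_mat complex_of_real (bernstein_to_legendre m) $$ (l, j) * d $ j)"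
    using C assms by (intro index_mult_mat_vec_atMost) auto
  also have "\<dots> = (\<Sum>j\<le>m. unit_integral (legendre_poly l * bernstein_poly m j) * d $ j)"
    using C assms by (intro sum.cong) (auto simp: bernstein_to_legendre_entry[symmetric])
  finally show ?thesis
    by (simp add: sum_distrib_left unit_integral_sum unit_integral_smult mult.commute)
qed

text \<open>The property by which \<open>legendre_to_bernstein\<close> is singled out, for an arbitrary matrix.\<close>
definition converts_legendre_to_bernstein :: "nat \<Rightarrow> real mat \<Rightarrow> bool"
  where "converts_legendre_to_bernstein m M \<longleftrightarrow> M \<in> carrier_mat (m + 1) (m + 1) \<and> invertible_mat M \<and>
    (\<forall>c \<in> carrier_vec (m + 1). \<forall>d \<in> carrier_vec (m + 1).
       (\<Sum>k\<le>m. Polynomial.smult (c $ k) (legendre_poly k)) = (\<Sum>j\<le>m. Polynomial.smult (d $ j) (bernstein_poly m j))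
       \<longleftrightarrow> d = map_mat complex_of_real M *\<^sub>v c)"

text \<open>Expanding each Legendre polynomial in Bernstein polynomials gives a right inverse \<open>M\<close> of
\<open>bernstein_to_legendre m\<close>, hence a two-sided one. Testing an identity between a Legendre sum and a
Bernstein sum against all Legendre polynomials recovers \<open>c\<close> from \<open>d\<close>, hence \<open>d\<close> from \<open>c\<close>;
so linear independence of the Bernstein polynomials comes for free.\<close>
lemma converts_legendre_to_bernstein_exists:
  "\<exists>M. converts_legendre_to_bernstein m M \<and> bernstein_to_legendre m * M = 1\<^sub>m (m + 1)"
proof -
  let ?A = "bernstein_to_legendre m"
  note A = bernstein_to_legendre_carrier[of m]
  have "\<forall>k\<in>{..m}. \<exists>e. legendre_poly k = (\<Sum>j\<le>m. Polynomial.smult (complex_of_real (e j)) (bernstein_poly m j))"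
    using legendre_poly_bernstein by simp
  from bchoice[OF this] obtain e where e: "\<And>k. k \<le> m \<Longrightarrow>
      legendre_poly k = (\<Sum>j\<le>m. Polynomial.smult (complex_of_real (e k j)) (bernstein_poly m j))"
    by auto
  define M where "M = mat (m + 1) (m + 1) (\<lambda>(j, k). e k j)"
  have M: "M \<in> carrier_mat (m + 1) (m + 1)" by (simp add: M_def)
  have AM: "?A * M = 1\<^sub>m (m + 1)"
  proof (rule eq_matI)
    fix l k assume "l < dim_row (1\<^sub>m (m + 1) :: real mat)" "k < dim_col (1\<^sub>m (m + 1) :: real mat)"
    then have lk: "l \<le> m" "k \<le> m" by auto
    have "complex_of_real ((?A * M) $$ (l, k)) = (\<Sum>j\<le>m. complex_of_real (?A $$ (l, j)) * complex_of_real (e k j))"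
      using lk A M by (simp add: scalar_prod_def atLeast0LessThan lessThan_Suc_atMost M_def)
    also have "\<dots> = (\<Sum>j\<le>m. complex_of_real (e k j) * unit_integral (legendre_poly l * bernstein_poly m j))"
      using lk by (intro sum.cong) (auto simp: bernstein_to_legendre_entry)
    also have "\<dots> = unit_integral (legendre_poly l * legendre_poly k)"
      unfolding e[OF lk(2)] by (simp add: sum_distrib_left unit_integral_sum unit_integral_smult)
    also have "\<dots> = complex_of_real (1\<^sub>m (m + 1) $$ (l, k))"
      using lk by (simp add: legendre_orthonormal)
    finally show "(?A * M) $$ (l, k) = 1\<^sub>m (m + 1) $$ (l, k)" by (simp only: of_real_eq_iff)
  qed (use A M in auto)
  have MA: "M * ?A = 1\<^sub>m (m + 1)" by (rule mat_mult_left_right_inverse[OF A M AM])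
  have inv: "invertible_mat M"
    unfolding invertible_mat_def inverts_mat_def using A M AM MA by auto
  let ?Mc = "map_mat complex_of_real M" and ?Ac = "map_mat complex_of_real ?A"
  have McAc: "?Mc * ?Ac = 1\<^sub>m (m + 1)"
    using of_real_hom.mat_hom_mult[OF M A, where 'a = complex] MA by (simp add: of_real_hom.mat_hom_one)
  have "(\<Sum>k\<le>m. Polynomial.smult (c $ k) (legendre_poly k)) = (\<Sum>j\<le>m. Polynomial.smult (d $ j) (bernstein_poly m j))
       \<longleftrightarrow> d = ?Mc *\<^sub>v c"
    if c: "c \<in> carrier_vec (m + 1)" and d: "d \<in> carrier_vec (m + 1)" for c d
  proof
    assume eq: "(\<Sum>k\<le>m. Polynomial.smult (c $ k) (legendre_poly k)) = (\<Sum>j\<le>m. Polynomial.smult (d $ j) (bernstein_poly m j))"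
    have "c = ?Ac *\<^sub>v d"
    proof (rule eq_vecI)
      fix l assume "l < dim_vec (?Ac *\<^sub>v d)"
      then have l: "l \<le> m" using A by simp
      show "c $ l = (?Ac *\<^sub>v d) $ l"
        using unit_integral_legendre_sum[OF l, of "\<lambda>k. c $ k"] unit_integral_bernstein_sum[OF l d] eq by simp
    qed (use A c in auto)
    then have "?Mc *\<^sub>v c = (?Mc * ?Ac) *\<^sub>v d"
      using A M d by (subst assoc_mult_mat_vec[of _ "m + 1" "m + 1" _ "m + 1"]) auto
    then show "d = ?Mc *\<^sub>v c" using McAc d by simp
  next
    assume "d = ?Mc *\<^sub>v c"
    then have "d $ j = (\<Sum>k\<le>m. complex_of_real (e k j) * c $ k)" if "j \<le> m" for j
      using index_mult_mat_vec_atMost[of ?Mc m c j] M c that by (simp add: M_def)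
    then have "(\<Sum>j\<le>m. Polynomial.smult (d $ j) (bernstein_poly m j))
      = (\<Sum>j\<le>m. \<Sum>k\<le>m. Polynomial.smult (c $ k) (Polynomial.smult (complex_of_real (e k j)) (bernstein_poly m j)))"
      by (simp add: smult_sum mult.commute)
    also have "\<dots> = (\<Sum>k\<le>m. Polynomial.smult (c $ k) (legendre_poly k))"
      by (subst sum.swap) (simp add: e smult_sum2 cong: sum.cong_simp)
    finally show "(\<Sum>k\<le>m. Polynomial.smult (c $ k) (legendre_poly k)) = (\<Sum>j\<le>m. Polynomial.smult (d $ j) (bernstein_poly m j))" ..
  qed
  with M inv AM show ?thesis unfolding converts_legendre_to_bernstein_def by blast
qed

text \<open>Applied to the unit vectors, the defining property determines the columns.\<close>
lemma converts_legendre_to_bernstein_unique: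
  assumes "converts_legendre_to_bernstein m M" "converts_legendre_to_bernstein m N"
  shows "M = N"
proof -
  have carr: "M \<in> carrier_mat (m + 1) (m + 1)" "N \<in> carrier_mat (m + 1) (m + 1)"
    using assms by (auto simp: converts_legendre_to_bernstein_def)
  let ?Mc = "map_mat complex_of_real M" and ?Nc = "map_mat complex_of_real N"
  have eq: "?Mc *\<^sub>v c = ?Nc *\<^sub>v c" if "c \<in> carrier_vec (m + 1)" for c
  proof -
    have "?Mc *\<^sub>v c \<in> carrier_vec (m + 1)"
      using carr that by (intro mult_mat_vec_carrier[of _ _ "m + 1"]) auto
    then show ?thesis using assms that unfolding converts_legendre_to_bernstein_def by blast
  qed
  have "?Mc = ?Nc"
  proof (rule mat_col_eqI)
    fix k assume "k < dim_col ?Nc"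
    then have k: "k < m + 1" using carr by simp
    have "col ?Mc k = ?Mc *\<^sub>v unit_vec (m + 1) k"
      using carr k by (intro mult_mat_unit_vec[symmetric]) auto
    also have "\<dots> = ?Nc *\<^sub>v unit_vec (m + 1) k" by (intro eq) simp
    also have "\<dots> = col ?Nc k"
      using carr k by (intro mult_mat_unit_vec) auto
    finally show "col ?Mc k = col ?Nc k" .
  qed (use carr in auto)
  then show ?thesis by (simp add: of_real_hom.mat_hom_inj)
qed

lemma converts_legendre_to_bernstein: "converts_legendre_to_bernstein m (legendre_to_bernstein m)"
proof -
  have "\<exists>!M. converts_legendre_to_bernstein m M"
    using converts_legendre_to_bernstein_exists[of m] converts_legendre_to_bernstein_unique[of m] by blast
  then have "converts_legendre_to_bernstein m (THE M. converts_legendre_to_bernstein m M)" by (rule theI')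
  then show ?thesis unfolding legendre_to_bernstein_def converts_legendre_to_bernstein_def .
qed

lemma bernstein_to_legendre_inverse:
  "bernstein_to_legendre m * legendre_to_bernstein m = 1\<^sub>m (m + 1)"
  using converts_legendre_to_bernstein_exists converts_legendre_to_bernstein_unique[OF converts_legendre_to_bernstein]
  by metis

lemma legendre_to_bernstein_carrier: "legendre_to_bernstein m \<in> carrier_mat (m + 1) (m + 1)"
  using converts_legendre_to_bernstein[of m] by (simp add: converts_legendre_to_bernstein_def)

lemma legendre_eq_bernstein_iff:
  assumes "c \<in> carrier_vec (m + 1)" "d \<in> carrier_vec (m + 1)"
  shows "(\<Sum>k\<le>m. Polynomial.smult (c $ k) (legendre_poly k)) = (\<Sum>j\<le>m. Polynomial.smult (d $ j) (bernstein_poly m j))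
    \<longleftrightarrow> d = map_mat complex_of_real (legendre_to_bernstein m) *\<^sub>v c"
  using converts_legendre_to_bernstein[of m] assms unfolding converts_legendre_to_bernstein_def by blast

lemma mat_inverse_legendre_to_bernstein:
  "mat_inverse (legendre_to_bernstein m) = Some (bernstein_to_legendre m)"
proof -
  note A = bernstein_to_legendre_carrier[of m] and M = legendre_to_bernstein_carrier[of m]
  note AM = bernstein_to_legendre_inverse[of m]
  note MA = mat_mult_left_right_inverse[OF A M AM]
  have "legendre_to_bernstein m \<in> Units (ring_mat TYPE(real) (m + 1) ())"
    unfolding Units_def using A M AM MA by (auto simp: ring_mat_simps)
  then obtain B where B: "mat_inverse (legendre_to_bernstein m) = Some B"
    using mat_inverse(1)[OF M, where b = "()"] by (cases "mat_inverse (legendre_to_bernstein m)") auto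
  have "legendre_to_bernstein m * B = 1\<^sub>m (m + 1)" "B \<in> carrier_mat (m + 1) (m + 1)"
    using mat_inverse(2)[OF M B] by auto
  then have "bernstein_to_legendre m = B"
    using A M AM by (metis assoc_mult_mat left_mult_one_mat right_mult_one_mat)
  with B show ?thesis by simp
qed

section \<open>The largest singular value of the inverse\<close>

lemma poly_norm_real_sum_legendre:
  assumes "p = (\<Sum>k\<le>m. Polynomial.smult (complex_of_real (c k)) (legendre_poly k))"
  shows "(poly_norm p)\<^sup>2 = (\<Sum>k\<le>m. (c k)\<^sup>2)"
proof -
  define f where "f t = (\<Sum>k\<le>m. c k *
    (sqrt (2 * real k + 1) * (\<Sum>i\<le>k. (-1) ^ (k + i) * real (k choose i) * Bernstein k i t)))" for t
  have f: "poly p (complex_of_real t) = complex_of_real (f t)" for t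
    by (simp add: assms poly_sum poly_legendre_poly_of_real f_def)
  have cont: "(\<lambda>t. (f t)\<^sup>2) integrable_on {0..1}"
    unfolding f_def Bernstein_def by (intro integrable_continuous_interval continuous_intros)
  have "complex_of_real ((poly_norm p)\<^sup>2) = complex_of_real (integral {0..1} (\<lambda>t. (f t)\<^sup>2))"
    unfolding poly_norm_def f by (simp add: integral_nonneg[OF cont])
  also have "\<dots> = unit_integral (p * p)"
    by (rule unit_integral_of_real[where f = "\<lambda>t. (f t)\<^sup>2", symmetric])
      (use cont in \<open>simp_all add: f power2_eq_square has_integral_integrable_integral\<close>)
  also have "\<dots> = (\<Sum>k\<le>m. complex_of_real (c k) * unit_integral (legendre_poly k * p))"
    by (subst assms) (simp add: sum_distrib_right unit_integral_sum unit_integral_smult)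
  also have "\<dots> = complex_of_real (\<Sum>k\<le>m. (c k)\<^sup>2)"
    unfolding assms by (simp add: unit_integral_legendre_sum power2_eq_square)
  finally show ?thesis by (simp only: of_real_eq_iff)
qed

text \<open>The left-hand side is, by Parseval, the squared norm of the polynomial whose Bernstein coefficients
are \<open>v\<close>.\<close>
lemma bernstein_to_legendre_contraction:
  assumes v: "v \<in> carrier_vec (m + 1)"
  shows "scalar_prod (bernstein_to_legendre m *\<^sub>v v) (bernstein_to_legendre m *\<^sub>v v) \<le> scalar_prod v v / real (m + 1)"
proof -
  let ?A = "bernstein_to_legendre m" and ?M = "legendre_to_bernstein m"
  note A = bernstein_to_legendre_carrier[of m] and M = legendre_to_bernstein_carrier[of m]
  let ?c = "?A *\<^sub>v v"
  have c: "?c \<in> carrier_vec (m + 1)" using A v by auto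
  have sq: "scalar_prod x x = (\<Sum>k\<le>m. (x $ k)\<^sup>2)" if "x \<in> carrier_vec (m + 1)" for x :: "real vec"
    using that by (simp add: scalar_prod_def atLeast0LessThan lessThan_Suc_atMost power2_eq_square)
  have "?M *\<^sub>v ?c = (?M * ?A) *\<^sub>v v" using A M v by simp
  also have "\<dots> = v" using mat_mult_left_right_inverse[OF A M bernstein_to_legendre_inverse] v by simp
  finally have conv: "map_vec complex_of_real v = map_mat complex_of_real ?M *\<^sub>v map_vec complex_of_real ?c"
    using of_real_hom.mult_mat_vec_hom[OF M c, where 'a = complex] by simp
  have "(\<Sum>k\<le>m. Polynomial.smult (map_vec complex_of_real ?c $ k) (legendre_poly k))
     = (\<Sum>j\<le>m. Polynomial.smult (map_vec complex_of_real v $ j) (bernstein_poly m j))"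
    by (rule iffD2[OF legendre_eq_bernstein_iff conv]) (use c v in auto)
  moreover have "map_vec complex_of_real x $ k = complex_of_real (x $ k)"
    if "k \<le> m" "x \<in> carrier_vec (m + 1)" for x k
    using that by simp
  ultimately have eq: "(\<Sum>j\<le>m. Polynomial.smult (complex_of_real (v $ j)) (bernstein_poly m j))
    = (\<Sum>k\<le>m. Polynomial.smult (complex_of_real (?c $ k)) (legendre_poly k))"
    using c v by (simp del: index_mult_mat_vec index_map_vec cong: sum.cong_simp)
  have "scalar_prod ?c ?c = (\<Sum>k\<le>m. (?c $ k)\<^sup>2)" by (rule sq[OF c])
  also have "\<dots> \<le> (\<Sum>k\<le>m. (cmod (complex_of_real (v $ k)))\<^sup>2) / real (m + 1)"
    unfolding poly_norm_real_sum_legendre[OF eq, symmetric] by (rule bernstein_norm_bound)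
  finally show ?thesis using sq[OF v] by simp
qed

text \<open>For an eigenvector \<open>v\<close> of \<open>A\<^sup>T A\<close> to the eigenvalue \<open>x\<close> one has \<open>x |v|\<^sup>2 = |A v|\<^sup>2\<close>.\<close>
lemma bernstein_to_legendre_eigenvalue_le:
  assumes "eigenvalue (transpose_mat (bernstein_to_legendre m) * bernstein_to_legendre m) x"
  shows "x \<le> 1 / real (m + 1)"
proof -
  let ?A = "bernstein_to_legendre m"
  note A = bernstein_to_legendre_carrier[of m]
  obtain v where v: "v \<in> carrier_vec (m + 1)" "v \<noteq> 0\<^sub>v (m + 1)" "(transpose_mat ?A * ?A) *\<^sub>v v = x \<cdot>\<^sub>v v"
    using assms A unfolding eigenvalue_def eigenvector_def by auto
  have "scalar_prod v v > 0"
    using conjugate_square_greater_0_vec[OF v(1)] v(2) by simp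
  have "x * scalar_prod v v = scalar_prod ((transpose_mat ?A * ?A) *\<^sub>v v) v"
    using v by simp
  also have "\<dots> = scalar_prod (transpose_mat ?A *\<^sub>v (?A *\<^sub>v v)) v"
    using A v by (subst assoc_mult_mat_vec[of _ "m + 1" "m + 1" _ "m + 1"]) auto
  also have "\<dots> = scalar_prod (?A *\<^sub>v v) (?A *\<^sub>v v)"
    by (rule transpose_vec_mult_scalar[OF A v(1)]) (use A v in auto)
  also have "\<dots> \<le> scalar_prod v v / real (m + 1)"
    by (rule bernstein_to_legendre_contraction[OF v(1)])
  finally have "x * scalar_prod v v \<le> 1 / real (m + 1) * scalar_prod v v" by simp
  then show ?thesis using \<open>scalar_prod v v > 0\<close> by (rule mult_right_le_imp_le)
qed

text \<open>The vector of ones is an eigenvector: it encodes the constant polynomial 1, which is the Legendre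
polynomial of degree 0, so \<open>A\<close> maps it to the first unit vector. \<open>A\<^sup>T\<close> maps that to the
first row of \<open>A\<close>, whose entries are the integrals of the Bernstein polynomials.\<close>
lemma bernstein_to_legendre_eigenvalue_max:
  "eigenvalue (transpose_mat (bernstein_to_legendre m) * bernstein_to_legendre m) (1 / real (m + 1))"
proof -
  let ?A = "bernstein_to_legendre m" and ?u = "vec (m + 1) (\<lambda>_. 1 :: real)"
  note A = bernstein_to_legendre_carrier[of m]
  have row: "?A $$ (0, j) = 1 / real (m + 1)" if "j \<le> m" for j
  proof -
    have "complex_of_real (?A $$ (0, j)) = complex_of_real (1 / real (m + 1))"
      unfolding bernstein_to_legendre_entry[OF le0 that] legendre_poly_0
      by (rule unit_integral_of_real[OF _ has_integral_Bernstein[OF that]]) (simp add: poly_bernstein_poly)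
    then show ?thesis by (simp only: of_real_eq_iff)
  qed
  have Au: "?A *\<^sub>v ?u = unit_vec (m + 1) 0"
  proof (rule eq_vecI)
    fix k assume "k < dim_vec (unit_vec (m + 1) 0 :: real vec)"
    then have k: "k \<le> m" by simp
    have "complex_of_real ((?A *\<^sub>v ?u) $ k) = (\<Sum>j\<le>m. complex_of_real (?A $$ (k, j)))"
      by (subst index_mult_mat_vec_atMost[OF A _ k]) auto
    also have "\<dots> = (\<Sum>j\<le>m. unit_integral (legendre_poly k * bernstein_poly m j))"
      using k by (intro sum.cong) (auto simp: bernstein_to_legendre_entry)
    also have "\<dots> = unit_integral (legendre_poly k * legendre_poly 0)"
      by (simp add: unit_integral_sum[symmetric] sum_distrib_left[symmetric] sum_bernstein_poly legendre_poly_0)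
    also have "\<dots> = complex_of_real (unit_vec (m + 1) 0 $ k)"
      unfolding legendre_orthonormal using k by simp
    finally show "(?A *\<^sub>v ?u) $ k = unit_vec (m + 1) 0 $ k" by (simp only: of_real_eq_iff)
  qed (use A in auto)
  have "(transpose_mat ?A * ?A) *\<^sub>v ?u = transpose_mat ?A *\<^sub>v unit_vec (m + 1) 0"
    using A Au by (subst assoc_mult_mat_vec[of _ "m + 1" "m + 1" _ "m + 1"]) auto
  also have "\<dots> = col (transpose_mat ?A) 0"
    using A by (intro mult_mat_unit_vec) auto
  also have "\<dots> = (1 / real (m + 1)) \<cdot>\<^sub>v ?u"
    using A row by (intro eq_vecI) auto
  finally have "(transpose_mat ?A * ?A) *\<^sub>v ?u = (1 / real (m + 1)) \<cdot>\<^sub>v ?u" .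
  moreover have "?u \<noteq> 0\<^sub>v (m + 1)"
  proof
    assume "?u = 0\<^sub>v (m + 1)"
    then have "?u $ 0 = 0\<^sub>v (m + 1) $ 0" by simp
    then show False by simp
  qed
  ultimately show ?thesis
    using A unfolding eigenvalue_def eigenvector_def by (intro exI[of _ ?u]) auto
qed

lemma sigma_max_bernstein_to_legendre:
  "sigma_max (bernstein_to_legendre m) = 1 / sqrt (real (m + 1))"
proof -
  let ?G = "transpose_mat (bernstein_to_legendre m) * bernstein_to_legendre m"
  note A = bernstein_to_legendre_carrier[of m]
  have "?G \<in> carrier_mat (m + 1) (m + 1)" using A by auto
  then have "finite (spectrum ?G)" by (rule card_finite_spectrum)
  then have "Max (sqrt ` spectrum ?G) = sqrt (1 / real (m + 1))"
    using bernstein_to_legendre_eigenvalue_le[of m] bernstein_to_legendre_eigenvalue_max[of m]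
    by (intro Max_eqI) (auto simp: spectrum_def simp del: of_nat_add)
  then show ?thesis
    by (simp add: sigma_max_def singular_values_def real_sqrt_divide)
qed

section \<open>Perturbation of Bernstein coefficients\<close>

lemma bernstein_perturbation_norm:
  assumes "L2_set (\<lambda>k. cmod (d k)) {..m} \<le> sqrt (real (m + 1)) * \<Delta>"
    and "\<Delta> > 0"
  shows "poly_norm (\<Sum>k\<le>m. Polynomial.smult (d k) (bernstein_poly m k)) \<le> \<Delta>" (is "poly_norm ?p \<le> _")
proof -
  define N where "N = real (m + 1)"
  have N: "N > 0" by (simp add: N_def)
  have "(poly_norm ?p)\<^sup>2 \<le> (L2_set (\<lambda>k. cmod (d k)) {..m})\<^sup>2 / N"
    unfolding L2_set_def N_def
    using bernstein_norm_bound[where d = d and m = m] by (subst real_sqrt_pow2) (auto intro: sum_nonneg simp del: of_nat_add of_nat_Suc)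
  also have "\<dots> \<le> (sqrt N * \<Delta>)\<^sup>2 / N"
    using assms N unfolding N_def[symmetric] by (intro divide_right_mono power_mono) auto
  also have "(sqrt N * \<Delta>)\<^sup>2 = N * \<Delta>\<^sup>2"
    using N by (simp only: power_mult_distrib real_sqrt_pow2 less_imp_le)
  finally have "(poly_norm ?p)\<^sup>2 \<le> \<Delta>\<^sup>2"
    using N by simp
  then show ?thesis
    using assms(2) by (rule power2_le_imp_le[OF _ less_imp_le])
qed

lemma poly_distance_add: "poly_distance w (w + dw) = poly_norm dw"
  by (simp add: poly_distance_def poly_norm_def)

theorem mainTheorem4:
  fixes m :: nat
  shows "sigma_max (the (mat_inverse (legendre_to_bernstein m))) = 1 / sqrt (real (m + 1))
    \<and> (\<forall>(\<Delta>::real) (w::complex poly) (dw::complex poly). \<forall>dW \<in> carrier_vec (m + 1).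
        \<Delta> > 0 \<longrightarrow> degree w \<le> m
        \<longrightarrow> dw = (\<Sum>k\<le>m. Polynomial.smult (dW $ k) (bernstein_poly m k))
        \<longrightarrow> L2_set (\<lambda>k. cmod (dW $ k)) {..m} \<le> sqrt (real (m + 1)) * \<Delta>
        \<longrightarrow> poly_distance w (w + dw) = poly_norm dw \<and> poly_norm dw \<le> \<Delta>)
    \<and> (\<forall>(\<Delta>::real) (r::real) (w::complex poly) (dw::complex poly). \<forall>dW \<in> carrier_vec (m + 1).
        \<Delta> > 0 \<longrightarrow> degree w \<le> m
        \<longrightarrow> dw = (\<Sum>k\<le>m. Polynomial.smult (dW $ k) (bernstein_poly m k))
        \<longrightarrow> (\<forall>k\<le>m. cmod (dW $ k) = r) \<longrightarrow> r \<le> \<Delta>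
        \<longrightarrow> poly_distance w (w + dw) = poly_norm dw \<and> poly_norm dw \<le> \<Delta>)"
proof (intro conjI allI ballI impI)
  show "sigma_max (the (mat_inverse (legendre_to_bernstein m))) = 1 / sqrt (real (m + 1))"
    by (simp add: mat_inverse_legendre_to_bernstein sigma_max_bernstein_to_legendre)
next
  fix \<Delta> r :: real and dw :: "complex poly" and dW
  assume "\<Delta> > 0" and dw: "dw = (\<Sum>k\<le>m. Polynomial.smult (dW $ k) (bernstein_poly m k))"
    and r: "\<forall>k\<le>m. cmod (dW $ k) = r" "r \<le> \<Delta>"
  have "r \<ge> 0" using r(1) by (metis le0 norm_ge_zero)
  have "L2_set (\<lambda>k. cmod (dW $ k)) {..m} = sqrt (real (m + 1)) * r"
    using r(1) \<open>r \<ge> 0\<close> by (simp add: L2_set_def real_sqrt_mult)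
  then show "poly_norm dw \<le> \<Delta>"
    unfolding dw using r(2) \<open>\<Delta> > 0\<close> by (intro bernstein_perturbation_norm) auto
qed (simp_all add: poly_distance_add bernstein_perturbation_norm)

end
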